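(* A metric space $(X,d)$ is bounded if and only if no subset of $X$ supports an anticontraction.
   Context: A metric space $(X,d)$ is bounded if $\operatorname{diam}(X):=\sup_{x,y\in X}d(x,y)<\infty$. An expansion on a metric space $(Y,d)$ is a mapping $T:Y\to Y$ such that $d(Tx,Ty)\ge d(x,y)$ for all $x,y\in Y$. An anticontraction on $(Y,d)$ is an expansion $T:Y\to Y$ for which there exists a constant $E>1$ (called an expansion constant) such that $d(Tx,Ty)\ge E\,d(x,y)$ for all $x,y\in Y$. A subset $A\subseteq X$, equipped with the restriction of $d$, supports an anticontraction if there exists an anticontraction $T:A\to A$.
   Formalization: "No subset of X" is read as "no subset of X with at least two points", because the empty set and every one-point subset support an anticontraction trivially, so the literal claim fails for every bounded space. *)

theory Defs
  imports "HOL-Analysis.Analysis" "HOL-Library.FuncSet"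
begin

text \<open>
  The diameter is a supremum of extended reals, so that an infinite diameter is a genuine value.
  For the empty space the supremum is \<open>-\<infinity>\<close>; only finiteness of the diameter from above matters.
\<close>

definition mdiam :: "'a set \<Rightarrow> ('a \<Rightarrow> 'a \<Rightarrow> real) \<Rightarrow> ereal" where
  "mdiam X d = (SUP x\<in>X. SUP y\<in>X. ereal (d x y))"

definition bounded_mspace :: "'a set \<Rightarrow> ('a \<Rightarrow> 'a \<Rightarrow> real) \<Rightarrow> bool" where
  "bounded_mspace X d \<longleftrightarrow> mdiam X d < \<infinity>"

definition expansion :: "'a set \<Rightarrow> ('a \<Rightarrow> 'a \<Rightarrow> real) \<Rightarrow> ('a \<Rightarrow> 'a) \<Rightarrow> bool" where
  "expansion Y d T \<longleftrightarrow> T \<in> Y \<rightarrow> Y \<and> (\<forall>x\<in>Y. \<forall>y\<in>Y. d (T x) (T y) \<ge> d x y)"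

definition anticontraction :: "'a set \<Rightarrow> ('a \<Rightarrow> 'a \<Rightarrow> real) \<Rightarrow> ('a \<Rightarrow> 'a) \<Rightarrow> bool" where
  "anticontraction Y d T \<longleftrightarrow>
     expansion Y d T \<and> (\<exists>E>1. \<forall>x\<in>Y. \<forall>y\<in>Y. d (T x) (T y) \<ge> E * d x y)"

definition supports_anticontraction :: "'a set \<Rightarrow> ('a \<Rightarrow> 'a \<Rightarrow> real) \<Rightarrow> bool" where
  "supports_anticontraction A d \<longleftrightarrow> (\<exists>T. anticontraction A d T)"

text \<open>
  The next two lemmas show that the empty set and every singleton support an anticontraction
  vacuously.  Hence the claim that no subset of a bounded space supports an
  anticontraction has to be read as a claim about subsets with at least two points.
\<close>

lemma supports_anticontraction_empty: "supports_anticontraction {} d"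
  by (auto simp: supports_anticontraction_def anticontraction_def expansion_def intro: exI[of _ 2])

lemma (in Metric_space) supports_anticontraction_singleton:
  assumes "a \<in> M"
  shows "supports_anticontraction {a} d"
  using assms
  by (auto simp: supports_anticontraction_def anticontraction_def expansion_def
      intro!: exI[of _ id] exI[of _ 2])

lemma (in Metric_space) bounded_mspace_iff_mbounded: "bounded_mspace M d \<longleftrightarrow> mbounded M"
proof
  assume bdd: "bounded_mspace M d"
  show "mbounded M"
  proof (cases "M = {}")
    case False
    have le: "ereal (d x y) \<le> mdiam M d" if "x \<in> M" "y \<in> M" for x y
      unfolding mdiam_def using that by (meson SUP_upper SUP_upper2)
    obtain a where "a \<in> M" using False by blast
    then have "mdiam M d \<noteq> -\<infinity>"
      using le[of a a] by auto
    then obtain B where "mdiam M d = ereal B"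
      using bdd unfolding bounded_mspace_def by (cases "mdiam M d") auto
    then show ?thesis
      using le unfolding mbounded_alt by (metis ereal_less_eq(3) order_refl)
  next
    case True
    then show ?thesis unfolding mbounded_alt by simp
  qed
next
  assume "mbounded M"
  then obtain B where "\<forall>x\<in>M. \<forall>y\<in>M. d x y \<le> B"
    unfolding mbounded_alt by blast
  then have "mdiam M d \<le> ereal B"
    unfolding mdiam_def by (auto intro!: SUP_least)
  then show "bounded_mspace M d"
    unfolding bounded_mspace_def by (auto simp: less_top[symmetric])
qed

end

theory Submission
  imports Defs
begin

text \<open>
  In a bounded space, iterating an anticontraction on two distinct points gives arbitrarily large
  distances. In an unbounded space, choose points \<open>x\<^sub>0, x\<^sub>1, \<dots>\<close> whose distances \<open>r\<^sub>n\<close> from \<open>x\<^sub>0\<close>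
  grow by a factor of more than 4 at each step. For \<open>n < m\<close> the distance of \<open>x\<^sub>n\<close> and \<open>x\<^sub>m\<close> lies
  between \<open>3/4 r\<^sub>m\<close> and \<open>5/4 r\<^sub>m\<close>, so the shift \<open>x\<^sub>n \<mapsto> x\<^sub>n\<^sub>+\<^sub>1\<close> at least doubles distances.
\<close>

text \<open>Both memberships are carried through the induction because \<open>expand\<close> applies
  only to points of \<open>A\<close>.\<close>

lemma anticontraction_iterate:
  assumes T: "T \<in> A \<rightarrow> A" and E: "E \<ge> 0" and "a \<in> A" "b \<in> A"
    and expand: "\<And>x y. x \<in> A \<Longrightarrow> y \<in> A \<Longrightarrow> d (T x) (T y) \<ge> E * (d x y :: real)"
  shows "(T ^^ n) a \<in> A \<and> (T ^^ n) b \<in> A \<and> d ((T ^^ n) a) ((T ^^ n) b) \<ge> E ^ n * d a b"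
proof (induction n)
  case 0
  then show ?case using assms by simp
next
  case (Suc n)
  let ?a = "(T ^^ n) a" and ?b = "(T ^^ n) b"
  have "E ^ Suc n * d a b \<le> E * d ?a ?b"
    using Suc.IH E by (simp add: mult.assoc mult_left_mono)
  also have "\<dots> \<le> d (T ?a) (T ?b)"
    using Suc.IH expand by blast
  finally show ?case
    using Suc.IH T by auto
qed

context Metric_space
begin

lemma mbounded_anticontraction_trivial:
  assumes bdd: "mbounded M" and "A \<subseteq> M" and T: "anticontraction A d T" and "a \<in> A" "b \<in> A"
  shows "a = b"
proof (rule ccontr)
  assume "a \<noteq> b"
  then have pos: "d a b > 0"
    using assms by (meson mdist_pos_less subsetD)
  obtain B where B: "\<And>x y. x \<in> M \<Longrightarrow> y \<in> M \<Longrightarrow> d x y \<le> B"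
    using bdd unfolding mbounded_alt by blast
  obtain E where "E > 1" and "T \<in> A \<rightarrow> A"
    and E: "\<And>x y. x \<in> A \<Longrightarrow> y \<in> A \<Longrightarrow> d (T x) (T y) \<ge> E * d x y"
    using T unfolding anticontraction_def expansion_def by blast
  obtain n where "E ^ n > B / d a b"
    using \<open>E > 1\<close> real_arch_pow by blast
  then have "B < E ^ n * d a b"
    using pos by (simp add: pos_divide_less_eq)
  moreover have "E ^ n * d a b \<le> d ((T ^^ n) a) ((T ^^ n) b)"
    and "d ((T ^^ n) a) ((T ^^ n) b) \<le> B"
    using anticontraction_iterate[where d = d and E = E, OF \<open>T \<in> A \<rightarrow> A\<close> _ \<open>a \<in> A\<close> \<open>b \<in> A\<close> E, of n]
      \<open>E > 1\<close> \<open>A \<subseteq> M\<close> B by (auto simp: subset_iff)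
  ultimately show False by linarith
qed

lemma unbounded_sequence:
  assumes "\<not> mbounded M"
  obtains x :: "nat \<Rightarrow> 'a"
  where "\<And>n. x n \<in> M" and "\<And>n. d (x 0) (x (Suc n)) > c * d (x 0) (x n)"
proof -
  obtain a where "a \<in> M"
    using assms mbounded_empty by (metis ex_in_conv)
  have far: "\<exists>y. y \<in> M \<and> d a y > B" for B
    using assms \<open>a \<in> M\<close> unfolding mbounded_def by (metis in_mcball not_le subsetI)
  \<comment> \<open>The clause for \<open>n = 0\<close> pins the start of the sequence to
    \<open>a\<close>, so that \<open>a\<close> can finally be replaced by
    \<open>x 0\<close>.\<close>
  have "\<exists>x. \<forall>n. (x n \<in> M \<and> (n = 0 \<longrightarrow> x n = a)) \<and> d a (x (Suc n)) > c * d a (x n)"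
    by (rule dependent_nat_choice) (use \<open>a \<in> M\<close> far in auto)
  then show thesis using that by metis
qed

text \<open>Injectivity lets \<open>inv x\<close> recover the index of a point, so the map really is
  the index shift. It also provides distinct points in the range.\<close>

lemma shift_anticontraction:
  assumes M: "\<And>n. x n \<in> M" and grow: "\<And>n. d (x 0) (x (Suc n)) > 4 * d (x 0) (x n)"
  shows "inj x" and "anticontraction (range x) d (\<lambda>p. x (Suc (inv x p)))"
proof -
  define r where "r n = d (x 0) (x n)" for n
  have step: "r (Suc n) > 4 * r n" and rnonneg: "r n \<ge> 0" for n
    using grow by (auto simp: r_def)
  \<comment> \<open>Strictness of \<open>grow\<close> matters at \<open>n = 0\<close>, where
    \<open>r 0 = 0\<close>.\<close>
  have "r n < r (Suc n)" for n
    using step[of n] rnonneg[of n] by linarith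
  then have mono: "strict_mono r"
    by (simp add: strict_mono_Suc_iff)
  have gap: "4 * r n < r m" if "n < m" for n m
  proof -
    have "4 * r n < r (Suc n)" by (rule step)
    also have "\<dots> \<le> r m" using that mono by (simp add: strict_mono_less_eq)
    finally show ?thesis .
  qed
  show "inj x"
    using mono unfolding r_def by (intro injI) (metis strict_mono_eq)
  have double_less: "2 * d (x n) (x m) \<le> d (x (Suc n)) (x (Suc m))" if "n < m" for n m
  proof -
    have "d (x n) (x m) \<le> r n + r m"
      using triangle[of "x n" "x 0" "x m"] M commute by (simp add: r_def)
    moreover have "r (Suc m) \<le> r (Suc n) + d (x (Suc n)) (x (Suc m))"
      using triangle M by (simp add: r_def)
    \<comment> \<open>The left side is at most \<open>2 * (5/4) * r m\<close>. The right side is at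
      least \<open>3/4 * r (Suc m)\<close>, which exceeds \<open>3 * r m\<close>. Hence growth
      factor 4 suffices for expansion constant 2.\<close>
    ultimately show ?thesis
      using gap[OF that] gap[of "Suc n" "Suc m"] that step[of m] rnonneg[of m] by linarith
  qed
  \<comment> \<open>The case \<open>n > m\<close> follows by symmetry of \<open>d\<close>; for
    \<open>n = m\<close> both sides vanish.\<close>
  have double: "2 * d (x n) (x m) \<le> d (x (Suc n)) (x (Suc m))" for n m
    using double_less[of n m] double_less[of m n] M
    by (cases n m rule: linorder_cases) (auto simp: commute)
  have "d (x n) (x m) \<le> d (x (Suc n)) (x (Suc m))" for n m
    using double[of n m] nonneg[of "x n" "x m"] by linarith
  then show "anticontraction (range x) d (\<lambda>p. x (Suc (inv x p)))"
    unfolding anticontraction_def expansion_def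
    using double \<open>inj x\<close> by (auto intro!: exI[of _ 2])
qed

end

theorem theorem7p1:
  fixes X :: "'a set" and d :: "'a \<Rightarrow> 'a \<Rightarrow> real"
  assumes "Metric_space X d"
  shows "bounded_mspace X d \<longleftrightarrow>
    \<not> (\<exists>A. A \<subseteq> X \<and> (\<exists>a\<in>A. \<exists>b\<in>A. a \<noteq> b) \<and> supports_anticontraction A d)"
proof -
  interpret Metric_space X d by fact
  have "\<exists>A. A \<subseteq> X \<and> (\<exists>a\<in>A. \<exists>b\<in>A. a \<noteq> b) \<and> supports_anticontraction A d"
    if unbdd: "\<not> mbounded X"
  proof -
    obtain x :: "nat \<Rightarrow> 'a" where x: "\<And>n. x n \<in> X" "\<And>n. d (x 0) (x (Suc n)) > 4 * d (x 0) (x n)"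
      using unbounded_sequence[OF unbdd] by blast
    note shift = shift_anticontraction[OF x]
    \<comment> \<open>These two points show that \<open>range x\<close> is not a singleton, for
      which the claim would be vacuous.\<close>
    have "x 0 \<noteq> x 1"
      using shift(1) by (simp add: inj_eq)
    then show ?thesis
      using shift(2) x(1) unfolding supports_anticontraction_def
      by (intro exI[of _ "range x"]) blast
  qed
  then show ?thesis
    using mbounded_anticontraction_trivial
    unfolding bounded_mspace_iff_mbounded supports_anticontraction_def by blast
qed

end
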